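(* Let $n\geq 1$ be an integer, let $t \in (0,1)$, and let $f : \{0,\ldots, n\} \to \mathbb{R}$ satisfy $\sum_{k=0}^n f(k)\, b_{n,t}(k)=0$. Then $$\sum_{k=0}^n b_{n,t}(k)\, f(k)^2 \leq n t(1-t) \sum_{k=0}^n b_{n,t}(k) \bigl( (\nabla_n f)(k) \bigr)^2.$$ Equality holds if and only if $f$ is a (real) linear combination of the functions $\phi_1(k) = \frac{1}{1-t}(k-nt)$ and $\phi_n(k)=n!\left(\frac{-t}{1-t}\right)^{n-k}$, $k\in\{0,\dots,n\}$.
   Context: The binomial weights are $b_{n,t}(k) = \binom{n}{k} t^k (1-t)^{n-k}$, $k\in\{0,\dots,n\}$. The finite difference operator $\nabla_n$ acts on functions $f:\{0,\dots,n\}\to\mathbb{R}$ by $$(\nabla_n f)(k) = \frac{k}{n}\bigl(f(k)-f(k-1)\bigr) + \frac{n-k}{n}\bigl(f(k+1)-f(k)\bigr),\qquad k\in\{0,\dots,n\},$$ where the terms involving $f(-1)$ (at $k=0$) and $f(n+1)$ (at $k=n$) have coefficient $0$ and are omitted. *)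

theory Defs
  imports "HOL-Analysis.Weierstrass_Theorems"
begin

text \<open>The binomial weight \<open>b\<^sub>n\<^sub>,\<^sub>t(k)\<close> is \<open>Bernstein n k t\<close>.  A function on
  \<open>{0, ..., n}\<close> is represented by \<open>f :: nat \<Rightarrow> real\<close>, of which only the values at
  \<open>k \<le> n\<close> matter.\<close>

text \<open>At \<open>k = 0\<close> the truncated predecessor \<open>k - 1\<close> is multiplied by \<open>0\<close>, and at \<open>k = n\<close>
  so is the value \<open>f (n + 1)\<close>, hence the operator depends on \<open>f\<close> restricted to
  \<open>{0, ..., n}\<close> only.\<close>

definition nabla :: "nat \<Rightarrow> (nat \<Rightarrow> real) \<Rightarrow> nat \<Rightarrow> real" where
  "nabla n f k =
     real k / real n * (f k - f (k - 1)) + (real n - real k) / real n * (f (k + 1) - f k)"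

definition phi_first :: "nat \<Rightarrow> real \<Rightarrow> nat \<Rightarrow> real" where
  "phi_first n t k = 1 / (1 - t) * (real k - real n * t)"

definition phi_last :: "nat \<Rightarrow> real \<Rightarrow> nat \<Rightarrow> real" where
  "phi_last n t k = fact n * (- t / (1 - t)) ^ (n - k)"

end

theory Submission
  imports Defs
begin

text \<open>
  A function \<open>f\<close> on \<open>{0, ..., n}\<close> is a symmetric function on the cube \<open>{0, 1}\<^sup>n\<close> with
  the product of Bernoulli measures of parameter \<open>t\<close>.  Let \<open>E\<close> be the mean, let
  \<open>\<langle>u, v\<rangle> = E (u * v)\<close>, and let \<open>L = \<Sum>\<^sub>i (id - E\<^sub>i)\<close>, where \<open>E\<^sub>i\<close> averages over the
  \<open>i\<close>-th coordinate.  The operator \<open>L\<close> is self-adjoint with eigenvalues \<open>0, 1, ..., n\<close>; the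
  eigenvalue \<open>0\<close> belongs to the constants, \<open>1\<close> to \<open>\<phi>\<^sub>1\<close> and \<open>n\<close> to \<open>\<phi>\<^sub>n\<close>.

  The identity
  \<open>n\<^sup>2 t (1 - t) \<parallel>\<nabla>f\<parallel>\<^sup>2 + \<parallel>L f\<parallel>\<^sup>2 = (n + 1) \<langle>f, L f\<rangle>\<close>
  (\<open>norm_nabla_plus_norm_bernoulli_laplacian\<close>) shows that \<open>n\<close> times the deficit, the right side
  of the inequality minus the left, is \<open>\<langle>(L - 1) f, (n - L) f\<rangle>\<close> (\<open>deficit_eq_inner_product\<close>).  On
  the eigenspace of \<open>m\<close> this form is multiplication by \<open>(m - 1) (n - m)\<close>, which is nonnegative for
  \<open>1 \<le> m \<le> n\<close> and vanishes exactly at \<open>m = 1\<close> and \<open>m = n\<close>.  That is the theorem.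

  The spectral argument is carried out through quadratic forms.  Put \<open>g = (n - L) f\<close> and
  \<open>h = (L - 1) f\<close>, so that \<open>g + h = (n - 1) f\<close>.  Self-adjointness of \<open>L\<close> gives
  (\<open>inner_product_split\<close>)
  \<open>(n - 1) \<langle>h, g\<rangle> = \<langle>g, (L - 1) g\<rangle> + \<langle>h, (n - L) h\<rangle>\<close>,
  and only the two ends of the spectrum matter:

  \<^item> \<open>\<langle>g, (L - 1) g\<rangle>\<close> is nonnegative because \<open>g\<close> has mean zero.  This is the Poincare
    inequality for the binomial distribution, proved by averaging out one coordinate at a time
    (\<open>binomial_poincare\<close>); the remainder in that induction controls the second differences of
    \<open>g\<close>, so equality forces \<open>g\<close> to be a multiple of \<open>\<phi>\<^sub>1\<close>.

  \<^item> \<open>\<langle>h, (n - L) h\<rangle> = \<Sum>\<^sub>i E (E\<^sub>i h)\<^sup>2\<close> is nonnegative, and it vanishes only if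
    \<open>t * h (k + 1) + (1 - t) * h k = 0\<close> for all \<open>k < n\<close>, that is, if \<open>h\<close> is a multiple of
    \<open>\<phi>\<^sub>n\<close>.

  For \<open>n > 1\<close> this settles the inequality and, by \<open>f = (g + h) / (n - 1)\<close>, the form of the
  extremal functions.  For \<open>n = 1\<close> every function of mean zero is a multiple of \<open>\<phi>\<^sub>1\<close>.
  Conversely, for \<open>f = a \<phi>\<^sub>1 + c \<phi>\<^sub>n\<close> the vectors \<open>g\<close> and \<open>h\<close> are multiples of
  \<open>\<phi>\<^sub>1\<close> and \<open>\<phi>\<^sub>n\<close>, which are orthogonal when \<open>n > 1\<close> and carry the factor
  \<open>n - 1 = 0\<close> when \<open>n = 1\<close>.  Throughout, \<open>n\<close> is written as \<open>Suc m\<close>.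
\<close>

section \<open>The binomial mean\<close>

definition binom_mean :: "nat \<Rightarrow> real \<Rightarrow> (nat \<Rightarrow> real) \<Rightarrow> real" where
  "binom_mean n t f = (\<Sum>k=0..n. Bernstein n k t * f k)"

lemma binom_mean_cong:
  assumes "\<And>k. k \<le> n \<Longrightarrow> f k = g k"
  shows "binom_mean n t f = binom_mean n t g"
  unfolding binom_mean_def by (intro sum.cong) (auto simp: assms)

lemma binom_mean_add: "binom_mean n t (\<lambda>k. f k + g k) = binom_mean n t f + binom_mean n t g"
  by (simp add: binom_mean_def distrib_left sum.distrib)

lemma binom_mean_diff: "binom_mean n t (\<lambda>k. f k - g k) = binom_mean n t f - binom_mean n t g"
  by (simp add: binom_mean_def right_diff_distrib sum_subtractf)

lemma binom_mean_scale: "binom_mean n t (\<lambda>k. c * f k) = c * binom_mean n t f"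
  by (simp add: binom_mean_def sum_distrib_left mult.left_commute)

lemmas binom_mean_linear = binom_mean_add binom_mean_diff binom_mean_scale

lemma binom_mean_const: "binom_mean n t (\<lambda>_. c) = c"
  by (simp add: binom_mean_def atLeast0AtMost flip: sum_distrib_right)

lemma binom_mean_nonneg:
  assumes "0 < t" "t < 1" "\<And>k. k \<le> n \<Longrightarrow> 0 \<le> f k"
  shows "0 \<le> binom_mean n t f"
  unfolding binom_mean_def using assms
  by (intro sum_nonneg mult_nonneg_nonneg Bernstein_nonneg) auto

lemma binom_mean_square_eq_0D:
  assumes "0 < t" "t < 1" "binom_mean n t (\<lambda>k. (f k)\<^sup>2) = 0" "k \<le> n"
  shows "f k = 0"
proof -
  have "\<forall>k\<in>{0..n}. Bernstein n k t * (f k)\<^sup>2 = 0"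
    using assms(1-3) unfolding binom_mean_def
    by (subst (asm) sum_nonneg_eq_0_iff) (auto intro!: mult_nonneg_nonneg Bernstein_nonneg)
  then have "Bernstein n k t * (f k)\<^sup>2 = 0" using assms(4) by simp
  then show ?thesis using Bernstein_pos[of t k n] assms by simp
qed

lemma Bernstein_Suc_Suc:
  "Bernstein (Suc n) (Suc k) t = t * Bernstein n k t + (1 - t) * Bernstein n (Suc k) t"
proof (cases "Suc k \<le> n")
  case True
  then have "n - k = Suc (n - Suc k)" by simp
  then show ?thesis by (simp add: Bernstein_def algebra_simps)
next
  case False
  then show ?thesis by (simp add: Bernstein_def algebra_simps)
qed

text \<open>Condition on the last of the \<open>n + 1\<close> Bernoulli variables.\<close>

lemma binom_mean_Suc:
  "binom_mean (Suc n) t f = binom_mean n t (\<lambda>k. t * f (Suc k) + (1 - t) * f k)"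
proof -
  have zero: "Bernstein (Suc n) 0 t = (1 - t) * Bernstein n 0 t"
    by (simp add: Bernstein_def)
  have "binom_mean (Suc n) t f = Bernstein (Suc n) 0 t * f 0
      + (\<Sum>k=0..n. Bernstein (Suc n) (Suc k) t * f (Suc k))"
    unfolding binom_mean_def
    by (subst sum.atLeast_Suc_atMost)
       (simp_all add: sum.shift_bounds_cl_Suc_ivl del: sum.cl_ivl_Suc)
  also have "\<dots> = t * (\<Sum>k=0..n. Bernstein n k t * f (Suc k))
      + (1 - t) * (Bernstein n 0 t * f 0 + (\<Sum>k=0..n. Bernstein n (Suc k) t * f (Suc k)))"
    by (simp add: Bernstein_Suc_Suc zero sum_distrib_left distrib_left distrib_right sum.distrib
        mult.assoc del: sum.cl_ivl_Suc)
  also have "Bernstein n 0 t * f 0 + (\<Sum>k=0..n. Bernstein n (Suc k) t * f (Suc k))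
      = (\<Sum>k=0..Suc n. Bernstein n k t * f k)"
    by (subst (2) sum.atLeast_Suc_atMost)
       (simp_all add: sum.shift_bounds_cl_Suc_ivl del: sum.cl_ivl_Suc)
  also have "\<dots> = (\<Sum>k=0..n. Bernstein n k t * f k)"
    by (simp add: Bernstein_def)
  finally show ?thesis
    by (simp add: binom_mean_linear) (simp add: binom_mean_def)
qed

text \<open>The factor \<open>k\<close> counts the coordinates equal to one.  By symmetry it amounts to
  \<open>m + 1\<close> times the indicator of one coordinate being one, and conditioning on that leaves \<open>m\<close>
  free coordinates.\<close>

lemma binom_mean_times_index:
  "binom_mean (Suc m) t (\<lambda>k. real k * f k) = real (Suc m) * t * binom_mean m t (\<lambda>k. f (Suc k))"
proof -
  have absorb: "Bernstein (Suc m) (Suc k) t * real (Suc k) = real (Suc m) * t * Bernstein m k t"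
    for k
  proof -
    have "real (Suc m choose Suc k) * real (Suc k) = real (Suc m) * real (m choose k)"
      by (simp only: of_nat_mult[symmetric] Suc_times_binomial_eq)
    then show ?thesis
      by (simp add: Bernstein_def mult_ac del: binomial_Suc_Suc of_nat_Suc)
  qed
  have "binom_mean (Suc m) t (\<lambda>k. real k * f k)
      = (\<Sum>k=0..m. Bernstein (Suc m) (Suc k) t * real (Suc k) * f (Suc k))"
    unfolding binom_mean_def
    by (subst sum.atLeast_Suc_atMost)
       (simp_all add: sum.shift_bounds_cl_Suc_ivl mult.assoc del: sum.cl_ivl_Suc of_nat_Suc)
  also have "\<dots> = real (Suc m) * t * binom_mean m t (\<lambda>k. f (Suc k))"
    unfolding binom_mean_def absorb sum_distrib_left by (simp add: mult.assoc)
  finally show ?thesis .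
qed

lemma binom_mean_times_coindex:
  "binom_mean (Suc m) t (\<lambda>k. (real (Suc m) - real k) * f k)
     = real (Suc m) * (1 - t) * binom_mean m t f"
proof -
  have "binom_mean (Suc m) t (\<lambda>k. (real (Suc m) - real k) * f k)
      = real (Suc m) * binom_mean (Suc m) t f - binom_mean (Suc m) t (\<lambda>k. real k * f k)"
    by (simp only: left_diff_distrib binom_mean_linear)
  also have "\<dots> = real (Suc m) * (1 - t) * binom_mean m t f"
    unfolding binom_mean_times_index binom_mean_Suc binom_mean_linear
    by (simp only: algebra_simps)
  finally show ?thesis .
qed

section \<open>The Laplacian of the binomial distribution\<close>

text \<open>This is \<open>\<Sum>\<^sub>i (id - E\<^sub>i)\<close> acting on symmetric functions on the cube
  \<open>{0, 1}\<^sup>n\<close>, written in terms of the number \<open>k\<close> of ones; \<open>E\<^sub>i\<close> averages over the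
  \<open>i\<close>-th coordinate.  Each of the \<open>k\<close> coordinates equal to one contributes
  \<open>(1 - t) * (f k - f (k - 1))\<close>, and each of the \<open>n - k\<close> coordinates equal to zero contributes
  \<open>t * (f k - f (k + 1))\<close>.\<close>

definition bernoulli_laplacian :: "nat \<Rightarrow> real \<Rightarrow> (nat \<Rightarrow> real) \<Rightarrow> nat \<Rightarrow> real" where
  "bernoulli_laplacian n t f k =
     (1 - t) * (real k * (f k - f (k - 1))) - t * ((real n - real k) * (f (k + 1) - f k))"

lemma bernoulli_laplacian_linear:
  "bernoulli_laplacian n t (\<lambda>k. a * f k + b * g k) k
     = a * bernoulli_laplacian n t f k + b * bernoulli_laplacian n t g k"
  by (simp add: bernoulli_laplacian_def algebra_simps)

lemma bernoulli_laplacian_cong: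
  assumes "\<And>k. k \<le> n \<Longrightarrow> f k = g k" "k \<le> n"
  shows "bernoulli_laplacian n t f k = bernoulli_laplacian n t g k"
  using assms by (cases "k = n") (auto simp: bernoulli_laplacian_def)

text \<open>Summation by parts: \<open>\<langle>u, L v\<rangle>\<close> is the Dirichlet form
  \<open>t (1 - t) \<Sum>\<^sub>i E (D\<^sub>i u * D\<^sub>i v)\<close>, where \<open>D\<^sub>i\<close> is the difference in the
  \<open>i\<close>-th coordinate, whose value depends only on the \<open>m\<close> other coordinates.  Its symmetry in
  \<open>u\<close> and \<open>v\<close> makes \<open>L\<close> self-adjoint.\<close>

lemma bernoulli_laplacian_dirichlet_form:
  "binom_mean (Suc m) t (\<lambda>k. u k * bernoulli_laplacian (Suc m) t v k)
     = real (Suc m) * (t * (1 - t)) *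
       binom_mean m t (\<lambda>k. (u (Suc k) - u k) * (v (Suc k) - v k))"
proof -
  have "binom_mean (Suc m) t (\<lambda>k. u k * bernoulli_laplacian (Suc m) t v k)
      = (1 - t) * binom_mean (Suc m) t (\<lambda>k. real k * (u k * (v k - v (k - 1))))
        - t * binom_mean (Suc m) t (\<lambda>k. (real (Suc m) - real k) * (u k * (v (k + 1) - v k)))"
    unfolding binom_mean_linear[symmetric] bernoulli_laplacian_def
    by (intro binom_mean_cong) (simp only: algebra_simps)
  also have "\<dots> = real (Suc m) * (t * (1 - t)) *
      (binom_mean m t (\<lambda>k. u (Suc k) * (v (Suc k) - v k))
        - binom_mean m t (\<lambda>k. u k * (v (Suc k) - v k)))"
    unfolding binom_mean_times_index binom_mean_times_coindex
    by (simp add: algebra_simps)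
  finally show ?thesis
    by (simp only: binom_mean_linear[symmetric] left_diff_distrib)
qed

lemma bernoulli_laplacian_self_adjoint:
  "binom_mean (Suc m) t (\<lambda>k. u k * bernoulli_laplacian (Suc m) t v k)
     = binom_mean (Suc m) t (\<lambda>k. bernoulli_laplacian (Suc m) t u k * v k)"
  using bernoulli_laplacian_dirichlet_form[of m t u v] bernoulli_laplacian_dirichlet_form[of m t v u]
  by (simp add: mult.commute)

lemma binom_mean_bernoulli_laplacian:
  "binom_mean (Suc m) t (bernoulli_laplacian (Suc m) t v) = 0"
  using bernoulli_laplacian_dirichlet_form[of m t "\<lambda>_. 1" v]
  by (simp add: binom_mean_const)

section \<open>The deficit as a quadratic form\<close>

text \<open>Let \<open>a\<close> and \<open>b\<close> be the two parts of \<open>n * nabla n f\<close>.  Since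
  \<open>L f = (1 - t) a - t b\<close>, the mixed terms on the left cancel and
  \<open>(1 - t) a\<^sup>2 + t b\<^sup>2\<close> remains.  Taking the factors \<open>k\<close> and \<open>n - k\<close> out of the mean
  leaves weights \<open>k + 1\<close> and \<open>n - k\<close> on the same squared difference, and these add up to
  \<open>n + 1\<close>.\<close>

lemma norm_nabla_plus_norm_bernoulli_laplacian:
  "(real (Suc m))\<^sup>2 * (t * (1 - t)) * binom_mean (Suc m) t (\<lambda>k. (nabla (Suc m) f k)\<^sup>2)
     + binom_mean (Suc m) t (\<lambda>k. (bernoulli_laplacian (Suc m) t f k)\<^sup>2)
   = (real (Suc m) + 1) * binom_mean (Suc m) t (\<lambda>k. f k * bernoulli_laplacian (Suc m) t f k)"
  (is "?lhs = ?rhs")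
proof -
  let ?N = "real (Suc m)"
  define a where "a k = real k * (f k - f (k - 1))" for k
  define b where "b k = (?N - real k) * (f (k + 1) - f k)" for k
  have nab: "?N * nabla (Suc m) f k = a k + b k" for k
    unfolding nabla_def a_def b_def by (simp add: field_simps del: of_nat_Suc)
  have cross: "?N\<^sup>2 * (t * (1 - t)) * (nabla (Suc m) f k)\<^sup>2 + (bernoulli_laplacian (Suc m) t f k)\<^sup>2
      = (1 - t) * (a k)\<^sup>2 + t * (b k)\<^sup>2" for k
  proof -
    have nab2: "?N\<^sup>2 * (t * (1 - t)) * (nabla (Suc m) f k)\<^sup>2 = t * (1 - t) * (a k + b k)\<^sup>2"
      unfolding nab[symmetric] power_mult_distrib by (simp only: mult_ac)
    have lap: "bernoulli_laplacian (Suc m) t f k = (1 - t) * a k - t * b k"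
      by (simp add: bernoulli_laplacian_def a_def b_def)
    show ?thesis unfolding nab2 lap by (simp add: power2_eq_square algebra_simps)
  qed
  have "?lhs = (1 - t) * binom_mean (Suc m) t (\<lambda>k. (a k)\<^sup>2) + t * binom_mean (Suc m) t (\<lambda>k. (b k)\<^sup>2)"
    unfolding binom_mean_linear[symmetric] cross ..
  also have "(\<lambda>k. (a k)\<^sup>2) = (\<lambda>k. real k * (real k * (f k - f (k - 1))\<^sup>2))"
    by (simp add: a_def power2_eq_square mult_ac)
  also have "(\<lambda>k. (b k)\<^sup>2) = (\<lambda>k. (?N - real k) * ((?N - real k) * (f (k + 1) - f k)\<^sup>2))"
    by (simp add: b_def power2_eq_square mult_ac)
  also have "(1 - t) * binom_mean (Suc m) t (\<lambda>k. real k * (real k * (f k - f (k - 1))\<^sup>2))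
      + t * binom_mean (Suc m) t (\<lambda>k. (?N - real k) * ((?N - real k) * (f (k + 1) - f k)\<^sup>2))
      = ?N * (t * (1 - t)) *
        (binom_mean m t (\<lambda>k. real (Suc k) * (f (Suc k) - f k)\<^sup>2)
          + binom_mean m t (\<lambda>k. (?N - real k) * (f (Suc k) - f k)\<^sup>2))"
    unfolding binom_mean_times_index binom_mean_times_coindex by (simp add: algebra_simps)
  also have "binom_mean m t (\<lambda>k. real (Suc k) * (f (Suc k) - f k)\<^sup>2)
          + binom_mean m t (\<lambda>k. (?N - real k) * (f (Suc k) - f k)\<^sup>2)
      = (?N + 1) * binom_mean m t (\<lambda>k. (f (Suc k) - f k)\<^sup>2)"
    unfolding binom_mean_linear[symmetric]
    by (intro binom_mean_cong) (simp add: algebra_simps)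
  finally show ?thesis
    unfolding bernoulli_laplacian_dirichlet_form
    by (simp only: power2_eq_square mult_ac)
qed

lemma deficit_eq_inner_product:
  "real (Suc m) * (real (Suc m) * t * (1 - t) * binom_mean (Suc m) t (\<lambda>k. (nabla (Suc m) f k)\<^sup>2)
       - binom_mean (Suc m) t (\<lambda>k. (f k)\<^sup>2))
   = binom_mean (Suc m) t (\<lambda>k. (bernoulli_laplacian (Suc m) t f k - f k)
       * (real (Suc m) * f k - bernoulli_laplacian (Suc m) t f k))"
proof -
  let ?L = "bernoulli_laplacian (Suc m) t f" and ?N = "real (Suc m)"
  have "(\<lambda>k. (?L k - f k) * (?N * f k - ?L k))
      = (\<lambda>k. (?N + 1) * (f k * ?L k) - (?L k)\<^sup>2 - ?N * (f k)\<^sup>2)"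
    by (simp add: algebra_simps power2_eq_square)
  then show ?thesis
    using norm_nabla_plus_norm_bernoulli_laplacian[of m t f]
    by (simp only: binom_mean_linear) (simp add: algebra_simps power2_eq_square)
qed

text \<open>As \<open>g + h = (n - 1) f\<close> and
  \<open>\<langle>h, g\<rangle> = \<langle>f, p\<rangle>\<close> for \<open>p = (n - L) (L - 1) f\<close>, the left side is
  \<open>\<langle>g, p\<rangle> + \<langle>h, p\<rangle>\<close>.  Reading \<open>p\<close> as \<open>(L - 1) g\<close> in the first term and as
  \<open>(n - L) h\<close> in the second gives the right side.  The point is to
  trade the product \<open>(L - 1) (n - L)\<close> for its two factors, whose forms are
  nonnegative separately: that of \<open>L - 1\<close> on functions of mean zero, that of \<open>n - L\<close> on all
  functions.\<close>

lemma inner_product_split: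
  fixes m t f
  defines "L \<equiv> bernoulli_laplacian (Suc m) t"
  defines "g \<equiv> \<lambda>k. real (Suc m) * f k - L f k"
  defines "h \<equiv> \<lambda>k. L f k - f k"
  shows "real m * binom_mean (Suc m) t (\<lambda>k. h k * g k)
    = (binom_mean (Suc m) t (\<lambda>k. g k * L g k) - binom_mean (Suc m) t (\<lambda>k. (g k)\<^sup>2))
      + (real (Suc m) * binom_mean (Suc m) t (\<lambda>k. (h k)\<^sup>2) - binom_mean (Suc m) t (\<lambda>k. h k * L h k))"
proof -
  let ?E = "binom_mean (Suc m) t" and ?N = "real (Suc m)"
  have Lg: "L g k = ?N * L f k - L (L f) k" for k
    using bernoulli_laplacian_linear[of "Suc m" t ?N f "-1" "L f" k] by (simp add: L_def g_def)
  have Lh: "L h k = L (L f) k - L f k" for k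
    using bernoulli_laplacian_linear[of "Suc m" t 1 "L f" "-1" f k] by (simp add: L_def h_def)
  have gh: "real m * f k = g k + h k" for k
    by (simp add: g_def h_def algebra_simps)
  have adj: "?E (\<lambda>k. f k * L h k) = ?E (\<lambda>k. L f k * h k)"
    unfolding L_def by (rule bernoulli_laplacian_self_adjoint)
  have "?E (\<lambda>k. h k * g k) = ?N * ?E (\<lambda>k. f k * h k) - ?E (\<lambda>k. L f k * h k)"
    unfolding binom_mean_linear[symmetric] g_def
    by (intro binom_mean_cong) (simp only: algebra_simps)
  also have "\<dots> = ?E (\<lambda>k. f k * (?N * h k - L h k))"
    unfolding adj[symmetric] binom_mean_linear[symmetric]
    by (intro binom_mean_cong) (simp only: algebra_simps)
  finally have "real m * ?E (\<lambda>k. h k * g k) = ?E (\<lambda>k. (real m * f k) * (?N * h k - L h k))"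
    by (simp only: binom_mean_scale mult.assoc)
  also have "\<dots> = ?E (\<lambda>k. (g k * L g k - (g k)\<^sup>2) + (?N * (h k)\<^sup>2 - h k * L h k))"
  proof (rule binom_mean_cong)
    fix k
    have comm: "?N * h k - L h k = L g k - g k"
      unfolding Lg Lh by (simp add: g_def h_def algebra_simps)
    have "(real m * f k) * (?N * h k - L h k)
        = g k * (?N * h k - L h k) + h k * (?N * h k - L h k)"
      by (simp only: gh distrib_right)
    also have "\<dots> = g k * (L g k - g k) + h k * (?N * h k - L h k)"
      by (simp only: comm)
    finally show "(real m * f k) * (?N * h k - L h k)
        = (g k * L g k - (g k)\<^sup>2) + (?N * (h k)\<^sup>2 - h k * L h k)"
      by (simp add: power2_eq_square right_diff_distrib mult.left_commute)
  qed
  finally show ?thesis by (simp only: binom_mean_linear)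
qed

section \<open>The upper end of the spectrum\<close>

text \<open>Second moment of a variable with values \<open>x\<close> and \<open>y\<close> as mean squared plus variance.\<close>

lemma bernoulli_mean_square:
  fixes t x y :: real
  shows "t * x\<^sup>2 + (1 - t) * y\<^sup>2 = (t * x + (1 - t) * y)\<^sup>2 + t * (1 - t) * (x - y)\<^sup>2"
  by (simp add: power2_eq_square algebra_simps)

text \<open>This is \<open>\<langle>h, (n - L) h\<rangle> = \<Sum>\<^sub>i E (E\<^sub>i h)\<^sup>2\<close>: the form of \<open>L\<close> collects the
  variances along the single coordinates, and subtracting them from the second moment leaves the
  squares of the averages.\<close>

lemma dimension_minus_dirichlet_form:
  "real (Suc m) * binom_mean (Suc m) t (\<lambda>k. (h k)\<^sup>2)
     - binom_mean (Suc m) t (\<lambda>k. h k * bernoulli_laplacian (Suc m) t h k)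
   = real (Suc m) * binom_mean m t (\<lambda>k. (t * h (Suc k) + (1 - t) * h k)\<^sup>2)"
proof -
  have "binom_mean (Suc m) t (\<lambda>k. (h k)\<^sup>2)
      = binom_mean m t (\<lambda>k. (t * h (Suc k) + (1 - t) * h k)\<^sup>2)
        + t * (1 - t) * binom_mean m t (\<lambda>k. (h (Suc k) - h k)\<^sup>2)"
    by (simp only: binom_mean_Suc bernoulli_mean_square binom_mean_linear)
  then show ?thesis
    unfolding bernoulli_laplacian_dirichlet_form power2_eq_square[symmetric] by algebra
qed

lemma phi_last_of_ratio:
  assumes "0 < t" "t < 1" "\<And>k. k < n \<Longrightarrow> t * h (Suc k) + (1 - t) * h k = 0" "k \<le> n"
  shows "h k = h n / fact n * phi_last n t k"
  using \<open>k \<le> n\<close>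
proof (induction rule: inc_induct)
  case base
  show ?case by (simp add: phi_last_def)
next
  case (step k)
  have "h k = (- t / (1 - t)) * h (Suc k)"
    using assms(3)[OF step.hyps(2)] assms(2) by (simp add: field_simps)
  also have "\<dots> = h n / fact n * phi_last n t k"
    using step.hyps(2) unfolding step.IH phi_last_def by (simp add: Suc_diff_Suc[symmetric])
  finally show ?case .
qed

section \<open>The Poincare inequality for the binomial distribution\<close>

text \<open>Averaging out the last coordinate replaces \<open>f\<close> by
  \<open>g k = t * f (k + 1) + (1 - t) * f k\<close>.  The variance drops by \<open>t (1 - t)\<close> times the mean of the
  squared differences.  The difference operator commutes with the averaging, so the mean squared
  difference drops by \<open>t (1 - t)\<close> times the mean of the squared second differences.  Hence the
  inequality for \<open>g\<close> gives the one for \<open>f\<close>, with a remainder in the second differences that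
  identifies the case of equality.  The remainder needs at least two coordinates, which is why the
  second part is stated for \<open>Suc (Suc m)\<close>.\<close>

lemma binomial_poincare:
  assumes "0 < t" "t < 1"
  shows "binom_mean (Suc m) t (\<lambda>k. (f k)\<^sup>2) - (binom_mean (Suc m) t f)\<^sup>2
           \<le> real (Suc m) * (t * (1 - t)) * binom_mean m t (\<lambda>k. (f (Suc k) - f k)\<^sup>2)"
    and "binom_mean (Suc (Suc m)) t (\<lambda>k. (f k)\<^sup>2) - (binom_mean (Suc (Suc m)) t f)\<^sup>2
           + real (Suc m) * (t * (1 - t))\<^sup>2
             * binom_mean m t (\<lambda>k. (f (Suc (Suc k)) - 2 * f (Suc k) + f k)\<^sup>2)
           \<le> real (Suc (Suc m)) * (t * (1 - t)) * binom_mean (Suc m) t (\<lambda>k. (f (Suc k) - f k)\<^sup>2)"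
proof -
  let ?v = "t * (1 - t)"
  let ?V = "\<lambda>n f. binom_mean n t (\<lambda>k. (f k)\<^sup>2) - (binom_mean n t f)\<^sup>2"
  have step: "?V (Suc (Suc m)) f
           + real (Suc m) * ?v\<^sup>2
             * binom_mean m t (\<lambda>k. (f (Suc (Suc k)) - 2 * f (Suc k) + f k)\<^sup>2)
           \<le> real (Suc (Suc m)) * ?v * binom_mean (Suc m) t (\<lambda>k. (f (Suc k) - f k)\<^sup>2)"
    if IH: "\<And>f. ?V (Suc m) f \<le> real (Suc m) * ?v * binom_mean m t (\<lambda>k. (f (Suc k) - f k)\<^sup>2)"
    for m f
  proof -
    define g where "g k = t * f (Suc k) + (1 - t) * f k" for k
    have var: "?V (Suc (Suc m)) f = ?V (Suc m) g
        + ?v * binom_mean (Suc m) t (\<lambda>k. (f (Suc k) - f k)\<^sup>2)"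
      unfolding binom_mean_Suc[of "Suc m"] bernoulli_mean_square g_def
      by (simp only: binom_mean_linear)
    have "binom_mean (Suc m) t (\<lambda>k. (f (Suc k) - f k)\<^sup>2)
        = binom_mean m t (\<lambda>k. (t * (f (Suc (Suc k)) - f (Suc k)) + (1 - t) * (f (Suc k) - f k))\<^sup>2)
          + ?v * binom_mean m t (\<lambda>k. ((f (Suc (Suc k)) - f (Suc k)) - (f (Suc k) - f k))\<^sup>2)"
      unfolding binom_mean_Suc[of m] bernoulli_mean_square by (simp only: binom_mean_linear)
    also have "(\<lambda>k. (t * (f (Suc (Suc k)) - f (Suc k)) + (1 - t) * (f (Suc k) - f k))\<^sup>2)
        = (\<lambda>k. (g (Suc k) - g k)\<^sup>2)"
      by (simp add: g_def algebra_simps)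
    also have "(\<lambda>k. ((f (Suc (Suc k)) - f (Suc k)) - (f (Suc k) - f k))\<^sup>2)
        = (\<lambda>k. (f (Suc (Suc k)) - 2 * f (Suc k) + f k)\<^sup>2)"
      by (simp add: algebra_simps)
    finally have grad: "binom_mean m t (\<lambda>k. (g (Suc k) - g k)\<^sup>2)
        = binom_mean (Suc m) t (\<lambda>k. (f (Suc k) - f k)\<^sup>2)
          - ?v * binom_mean m t (\<lambda>k. (f (Suc (Suc k)) - 2 * f (Suc k) + f k)\<^sup>2)"
      by simp
    show ?thesis
      using IH[of g] unfolding var grad by (simp add: algebra_simps power2_eq_square)
  qed
  have weak: "?V (Suc m) f \<le> real (Suc m) * ?v * binom_mean m t (\<lambda>k. (f (Suc k) - f k)\<^sup>2)" for m f
  proof (induction m arbitrary: f)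
    case 0
    show ?case
      by (simp add: binom_mean_def Bernstein_def power2_eq_square algebra_simps)
  next
    case (Suc m)
    have "0 \<le> real (Suc m) * ?v\<^sup>2
             * binom_mean m t (\<lambda>k. (f (Suc (Suc k)) - 2 * f (Suc k) + f k)\<^sup>2)"
      using assms by (intro mult_nonneg_nonneg binom_mean_nonneg) auto
    then show ?case using step[OF Suc, of f] by linarith
  qed
  show "?V (Suc m) f \<le> real (Suc m) * ?v * binom_mean m t (\<lambda>k. (f (Suc k) - f k)\<^sup>2)"
    by (rule weak)
  show "?V (Suc (Suc m)) f
           + real (Suc m) * ?v\<^sup>2
             * binom_mean m t (\<lambda>k. (f (Suc (Suc k)) - 2 * f (Suc k) + f k)\<^sup>2)
           \<le> real (Suc (Suc m)) * ?v * binom_mean (Suc m) t (\<lambda>k. (f (Suc k) - f k)\<^sup>2)"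
    by (rule step[OF weak])
qed

lemma affine_of_second_difference_0:
  fixes g :: "nat \<Rightarrow> real"
  assumes "\<And>k. k + 2 \<le> n \<Longrightarrow> g (Suc (Suc k)) - 2 * g (Suc k) + g k = 0"
  shows "k \<le> n \<Longrightarrow> g k = g 0 + real k * (g 1 - g 0)"
proof (induction k rule: less_induct)
  case (less k)
  consider "k = 0" | "k = 1" | j where "k = Suc (Suc j)"
    by (metis One_nat_def not0_implies_Suc)
  then show ?case
  proof cases
    case 3
    then show ?thesis
      using less.IH[of j] less.IH[of "Suc j"] less.prems assms[of j]
      by (simp add: algebra_simps)
  qed simp_all
qed

text \<open>The mean of \<open>k\<close> is \<open>n t\<close>, so mean zero forces the constant term \<open>c = - n t d\<close>.\<close>

lemma mean_0_affine_imp_phi_first: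
  assumes "t < 1" "binom_mean (Suc m) t g = 0"
    and aff: "\<And>k. k \<le> Suc m \<Longrightarrow> g k = c + real k * d"
    and "k \<le> Suc m"
  shows "g k = (1 - t) * d * phi_first (Suc m) t k"
proof -
  have "binom_mean (Suc m) t g = binom_mean (Suc m) t (\<lambda>k. c + real k * d)"
    by (intro binom_mean_cong aff)
  then have "c = - (real (Suc m) * t * d)"
    using assms(2) by (simp only: binom_mean_add binom_mean_times_index binom_mean_const)
  then show ?thesis
    using aff[OF \<open>k \<le> Suc m\<close>] assms(1)
    by (simp add: phi_first_def divide_simps del: of_nat_Suc) (simp add: algebra_simps)
qed

lemma poincare_dirichlet:
  assumes "0 < t" "t < 1" and mean: "binom_mean (Suc m) t g = 0"
  shows "binom_mean (Suc m) t (\<lambda>k. (g k)\<^sup>2)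
           \<le> binom_mean (Suc m) t (\<lambda>k. g k * bernoulli_laplacian (Suc m) t g k)"
  using binomial_poincare(1)[OF assms(1,2), of m g] mean
  unfolding bernoulli_laplacian_dirichlet_form by (simp add: power2_eq_square)

text \<open>Equality leaves no room for the remainder in \<open>binomial_poincare\<close>, so the second
  differences vanish and \<open>g\<close> is affine.\<close>

lemma poincare_equality:
  assumes "0 < t" "t < 1" and mean: "binom_mean (Suc m) t g = 0"
    and eq: "binom_mean (Suc m) t (\<lambda>k. g k * bernoulli_laplacian (Suc m) t g k)
               = binom_mean (Suc m) t (\<lambda>k. (g k)\<^sup>2)"
  shows "\<exists>a. \<forall>k\<le>Suc m. g k = a * phi_first (Suc m) t k"
proof -
  have second: "g (Suc (Suc k)) - 2 * g (Suc k) + g k = 0" if k: "k + 2 \<le> Suc m" for k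
  proof -
    obtain l where l: "m = Suc l" using k by (cases m) auto
    let ?D = "binom_mean l t (\<lambda>k. (g (Suc (Suc k)) - 2 * g (Suc k) + g k)\<^sup>2)"
    have "real (Suc l) * (t * (1 - t))\<^sup>2 * ?D \<le> 0"
      using binomial_poincare(2)[OF assms(1,2), of l g] eq mean
      unfolding l bernoulli_laplacian_dirichlet_form by (simp add: power2_eq_square)
    then have "?D \<le> 0"
      using assms(1,2) by (simp add: mult_le_0_iff)
    moreover have "0 \<le> ?D"
      using assms(1,2) by (intro binom_mean_nonneg) auto
    ultimately have "?D = 0" by simp
    from binom_mean_square_eq_0D[OF assms(1,2) this, of k] show ?thesis
      using k l by simp
  qed
  have "g k = g 0 + real k * (g 1 - g 0)" if "k \<le> Suc m" for k
    using second that by (rule affine_of_second_difference_0)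
  from mean_0_affine_imp_phi_first[OF \<open>t < 1\<close> mean this] show ?thesis by blast
qed

section \<open>The extremal functions\<close>

lemma bernoulli_laplacian_phi_first:
  "bernoulli_laplacian n t (phi_first n t) k = phi_first n t k"
proof -
  have "bernoulli_laplacian n t (phi_first n t) k
      = 1 / (1 - t) * ((1 - t) * real k - t * (real n - real k))"
    by (cases k) (simp_all add: bernoulli_laplacian_def phi_first_def algebra_simps
        flip: add_divide_distrib diff_divide_distrib)
  then show ?thesis by (simp add: phi_first_def algebra_simps)
qed

text \<open>Since \<open>(1 - t) \<phi>(k - 1) = - t \<phi>(k)\<close>, every coordinate has average zero:
  \<open>E\<^sub>i\<close> kills this function, and \<open>\<Sum>\<^sub>i (id - E\<^sub>i)\<close> multiplies it by \<open>n\<close>.\<close>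

lemma bernoulli_laplacian_phi_last:
  assumes "0 < t" "t < 1" "k \<le> n"
  shows "bernoulli_laplacian n t (phi_last n t) k = real n * phi_last n t k"
proof -
  have ratio: "(1 - t) * phi_last n t j = - t * phi_last n t (Suc j)" if "j < n" for j
    using that assms by (simp add: phi_last_def Suc_diff_Suc[symmetric] field_simps)
  have "(1 - t) * (real k * (phi_last n t k - phi_last n t (k - 1))) = real k * phi_last n t k"
  proof (cases k)
    case (Suc j)
    then have "(1 - t) * phi_last n t (k - 1) = - t * phi_last n t k"
      using ratio[of j] assms(3) by simp
    then show ?thesis by algebra
  qed simp
  moreover have "t * ((real n - real k) * (phi_last n t (k + 1) - phi_last n t k))
      = - (real n - real k) * phi_last n t k"
  proof (cases "k = n")
    case False
    have "t * (phi_last n t (k + 1) - phi_last n t k) = - phi_last n t k"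
      using ratio[of k] assms(3) False by (simp add: algebra_simps)
    then show ?thesis by (metis mult.left_commute mult_minus_right mult_minus_left)
  qed simp
  ultimately show ?thesis by (simp add: bernoulli_laplacian_def algebra_simps)
qed

text \<open>Eigenfunctions of a self-adjoint operator for the eigenvalues \<open>1\<close> and \<open>n\<close>, which
  differ because \<open>m > 0\<close>.\<close>

lemma phi_first_orthogonal_phi_last:
  assumes "0 < t" "t < 1" "m > 0"
  shows "binom_mean (Suc m) t (\<lambda>k. phi_first (Suc m) t k * phi_last (Suc m) t k) = 0"
proof -
  let ?p = "phi_first (Suc m) t" and ?q = "phi_last (Suc m) t"
  have "binom_mean (Suc m) t (\<lambda>k. ?p k * bernoulli_laplacian (Suc m) t ?q k)
      = binom_mean (Suc m) t (\<lambda>k. real (Suc m) * (?p k * ?q k))"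
    using assms by (intro binom_mean_cong) (simp add: bernoulli_laplacian_phi_last)
  then have "real (Suc m) * binom_mean (Suc m) t (\<lambda>k. ?p k * ?q k)
      = binom_mean (Suc m) t (\<lambda>k. ?p k * ?q k)"
    by (simp only: bernoulli_laplacian_self_adjoint bernoulli_laplacian_phi_first binom_mean_scale)
  then show ?thesis using assms(3) by simp
qed

text \<open>The first factor is \<open>m * c * phi_last\<close> and the second is \<open>m * a * phi_first\<close>, so
  orthogonality applies; for \<open>m = 0\<close> both factors are zero.\<close>

lemma deficit_eq_0_of_span:
  assumes "0 < t" "t < 1"
    and f: "\<And>k. k \<le> Suc m \<Longrightarrow> f k = a * phi_first (Suc m) t k + c * phi_last (Suc m) t k"
  shows "binom_mean (Suc m) t (\<lambda>k. (bernoulli_laplacian (Suc m) t f k - f k)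
       * (real (Suc m) * f k - bernoulli_laplacian (Suc m) t f k)) = 0"
proof -
  let ?p = "phi_first (Suc m) t" and ?q = "phi_last (Suc m) t"
  have "binom_mean (Suc m) t (\<lambda>k. (bernoulli_laplacian (Suc m) t f k - f k)
       * (real (Suc m) * f k - bernoulli_laplacian (Suc m) t f k))
      = binom_mean (Suc m) t (\<lambda>k. ((real m)\<^sup>2 * a * c) * (?p k * ?q k))"
  proof (rule binom_mean_cong)
    fix k assume k: "k \<le> Suc m"
    have "bernoulli_laplacian (Suc m) t f k
        = bernoulli_laplacian (Suc m) t (\<lambda>k. a * ?p k + c * ?q k) k"
      using f k by (rule bernoulli_laplacian_cong)
    then have L: "bernoulli_laplacian (Suc m) t f k = a * ?p k + c * (real (Suc m) * ?q k)"
      using assms k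
      by (simp only: bernoulli_laplacian_linear bernoulli_laplacian_phi_first
          bernoulli_laplacian_phi_last)
    show "(bernoulli_laplacian (Suc m) t f k - f k)
        * (real (Suc m) * f k - bernoulli_laplacian (Suc m) t f k)
        = ((real m)\<^sup>2 * a * c) * (?p k * ?q k)"
      unfolding L f[OF k] by (simp add: power2_eq_square algebra_simps)
  qed
  also have "\<dots> = 0"
    using phi_first_orthogonal_phi_last[of t m] assms
    by (cases "m = 0") (auto simp: binom_mean_scale binom_mean_const)
  finally show ?thesis .
qed

section \<open>The inequality and its equality case\<close>

text \<open>Both terms of \<open>inner_product_split\<close> are nonnegative: the mean of \<open>g\<close> is zero
  because those of \<open>f\<close> and \<open>L f\<close> are.  If their sum vanishes, each term is in its own case of
  equality, and these two cases supply the multiples of \<open>\<phi>\<^sub>1\<close> and \<open>\<phi>\<^sub>n\<close> that add up to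
  \<open>(n - 1) f\<close>.\<close>

lemma deficit_form_of_mean_0:
  fixes m t f
  defines "I \<equiv> binom_mean (Suc m) t (\<lambda>k. (bernoulli_laplacian (Suc m) t f k - f k)
           * (real (Suc m) * f k - bernoulli_laplacian (Suc m) t f k))"
  assumes t01: "0 < t" "t < 1" and mean: "binom_mean (Suc m) t f = 0"
  shows "0 \<le> I"
    and "I = 0 \<Longrightarrow>
      \<exists>a c. \<forall>k\<le>Suc m. f k = a * phi_first (Suc m) t k + c * phi_last (Suc m) t k"
proof -
  let ?E = "binom_mean (Suc m) t" and ?L = "bernoulli_laplacian (Suc m) t" and ?N = "real (Suc m)"
  define g where "g = (\<lambda>k. ?N * f k - ?L f k)"
  define h where "h = (\<lambda>k. ?L f k - f k)"
  have I: "I = ?E (\<lambda>k. h k * g k)" by (simp add: I_def g_def h_def)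
  have gmean: "?E g = 0"
    unfolding g_def by (simp add: binom_mean_linear binom_mean_bernoulli_laplacian mean)
  have hform: "?N * ?E (\<lambda>k. (h k)\<^sup>2) - ?E (\<lambda>k. h k * ?L h k)
      = ?N * binom_mean m t (\<lambda>k. (t * h (Suc k) + (1 - t) * h k)\<^sup>2)"
    by (rule dimension_minus_dirichlet_form)
  have hnonneg: "0 \<le> ?N * binom_mean m t (\<lambda>k. (t * h (Suc k) + (1 - t) * h k)\<^sup>2)"
    using t01 by (intro mult_nonneg_nonneg binom_mean_nonneg) auto
  have split: "real m * I = (?E (\<lambda>k. g k * ?L g k) - ?E (\<lambda>k. (g k)\<^sup>2))
      + ?N * binom_mean m t (\<lambda>k. (t * h (Suc k) + (1 - t) * h k)\<^sup>2)"
    unfolding I hform[symmetric] unfolding g_def h_def by (rule inner_product_split)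
  have gnonneg: "0 \<le> ?E (\<lambda>k. g k * ?L g k) - ?E (\<lambda>k. (g k)\<^sup>2)"
    using poincare_dirichlet[OF t01 gmean] by simp
  \<comment> \<open>For \<open>n = 1\<close> the factor \<open>n - 1\<close> in the split vanishes, so the split gives no information on \<open>I\<close>.\<close>
  have one_dim: "\<exists>a c. \<forall>k\<le>Suc m. f k = a * phi_first (Suc m) t k + c * phi_last (Suc m) t k"
    if "m = 0"
  proof -
    have aff: "f k = f 0 + real k * (f 1 - f 0)" if "k \<le> Suc m" for k
      using that \<open>m = 0\<close> by (cases k) auto
    have "f k = (1 - t) * (f 1 - f 0) * phi_first (Suc m) t k + 0 * phi_last (Suc m) t k"
      if "k \<le> Suc m" for k
      unfolding mult_zero_left add_0_right
      by (rule mean_0_affine_imp_phi_first[OF t01(2) mean aff that])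
    then show ?thesis by blast
  qed
  show "0 \<le> I"
  proof (cases "m = 0")
    case True
    with one_dim obtain a c where
      "\<forall>k\<le>Suc m. f k = a * phi_first (Suc m) t k + c * phi_last (Suc m) t k" by blast
    then have "I = 0" unfolding I_def by (intro deficit_eq_0_of_span[OF t01]) blast
    then show ?thesis by simp
  next
    case False
    have "0 \<le> real m * I"
      unfolding split by (rule add_nonneg_nonneg[OF gnonneg hnonneg])
    then show ?thesis using False by (simp add: zero_le_mult_iff)
  qed
  show "\<exists>a c. \<forall>k\<le>Suc m. f k = a * phi_first (Suc m) t k + c * phi_last (Suc m) t k" if "I = 0"
  proof (cases "m = 0")
    case True
    then show ?thesis by (rule one_dim)
  next
    case False
    have geq: "?E (\<lambda>k. g k * ?L g k) = ?E (\<lambda>k. (g k)\<^sup>2)"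
      and heq: "binom_mean m t (\<lambda>k. (t * h (Suc k) + (1 - t) * h k)\<^sup>2) = 0"
      using split gnonneg hnonneg that by (simp_all add: add_nonneg_eq_0_iff del: of_nat_Suc)
    obtain a where a: "\<And>k. k \<le> Suc m \<Longrightarrow> g k = a * phi_first (Suc m) t k"
      using poincare_equality[OF t01 gmean geq] by blast
    have ratio: "t * h (Suc k) + (1 - t) * h k = 0" if "k < Suc m" for k
      using binom_mean_square_eq_0D[OF t01 heq, of k] that by simp
    have h: "h k = h (Suc m) / fact (Suc m) * phi_last (Suc m) t k" if "k \<le> Suc m" for k
      using t01 ratio that by (rule phi_last_of_ratio)
    define c where "c = h (Suc m) / fact (Suc m)"
    have "f k = a / real m * phi_first (Suc m) t k + c / real m * phi_last (Suc m) t k"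
      if "k \<le> Suc m" for k
    proof -
      have "real m * f k = g k + h k" by (simp add: g_def h_def algebra_simps)
      also have "\<dots> = a * phi_first (Suc m) t k + c * phi_last (Suc m) t k"
        using a[OF that] h[OF that] by (simp add: c_def)
      finally show ?thesis using False by (simp add: field_simps)
    qed
    then show ?thesis by blast
  qed
qed

theorem theorem1p3:
  fixes n :: nat and t :: real and f :: "nat \<Rightarrow> real"
  assumes "n \<ge> 1" and "0 < t" and "t < 1"
    and "(\<Sum>k=0..n. f k * Bernstein n k t) = 0"
  shows "(\<Sum>k=0..n. Bernstein n k t * (f k)\<^sup>2)
           \<le> real n * t * (1 - t) * (\<Sum>k=0..n. Bernstein n k t * (nabla n f k)\<^sup>2)
       \<and> ((\<Sum>k=0..n. Bernstein n k t * (f k)\<^sup>2)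
           = real n * t * (1 - t) * (\<Sum>k=0..n. Bernstein n k t * (nabla n f k)\<^sup>2)
         \<longleftrightarrow> (\<exists>a c :: real. \<forall>k\<in>{0..n}. f k = a * phi_first n t k + c * phi_last n t k))"
proof -
  obtain m where n: "n = Suc m" using assms(1) by (cases n) auto
  have mean: "binom_mean (Suc m) t f = 0"
    using assms(4) by (simp add: binom_mean_def n mult.commute)
  define A where "A = binom_mean (Suc m) t (\<lambda>k. (f k)\<^sup>2)"
  define B where
    "B = real (Suc m) * t * (1 - t) * binom_mean (Suc m) t (\<lambda>k. (nabla (Suc m) f k)\<^sup>2)"
  define I where "I = binom_mean (Suc m) t (\<lambda>k. (bernoulli_laplacian (Suc m) t f k - f k)
           * (real (Suc m) * f k - bernoulli_laplacian (Suc m) t f k))"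
  have deficit: "real (Suc m) * (B - A) = I"
    unfolding A_def B_def I_def by (rule deficit_eq_inner_product)
  have "0 \<le> I" unfolding I_def by (rule deficit_form_of_mean_0(1)[OF assms(2,3) mean])
  then have le: "A \<le> B" unfolding deficit[symmetric] by (simp add: zero_le_mult_iff)
  have "A = B \<longleftrightarrow> I = 0" unfolding deficit[symmetric] by auto
  moreover have "I = 0 \<longleftrightarrow>
      (\<exists>a c. \<forall>k\<le>Suc m. f k = a * phi_first (Suc m) t k + c * phi_last (Suc m) t k)"
    using deficit_form_of_mean_0(2)[OF assms(2,3) mean] deficit_eq_0_of_span[OF assms(2,3)]
    unfolding I_def by blast
  ultimately show ?thesis
    using le unfolding A_def B_def binom_mean_def n
    by (simp only: Ball_def atLeastAtMost_iff le0 simp_thms)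
qed

end
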